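(* For every integer $m\geq 0$, $H(m,2)\leq\frac{83}{192}\,m\,2^{m-1}$.
   Context: A triangular choice multigraph (TCM) $\mathcal{G}$ on $[m]$ is obtained by choosing, for every 3-element subset $\{u,v,w\}\subseteq[m]$, exactly one of the pairs $uv,uw,vw$ and adding one copy of it as an edge. $m^{\mathcal{G}}_{xy}$ denotes the multiplicity of the pair $xy$. $w(\mathcal{G},2)=\sum_{xy\in\binom{[m]}{2}}2^{m^{\mathcal{G}}_{xy}}$, and $H(m,2)$ is the maximum of $w(\mathcal{G},2)$ over all TCMs on $[m]$. *)

theory Defs
  imports Complex_Main "HOL-Library.Multiset"
begin

definition vertex_subsets :: "nat \<Rightarrow> nat \<Rightarrow> nat set set" where
  "vertex_subsets m k = {S. S \<subseteq> {1..m} \<and> card S = k}"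

text \<open>A multigraph on \<open>{1..m}\<close> is represented by the multiset of its edges, each edge being
  a 2-element set of vertices; the multiplicity of \<open>e\<close> is \<open>count G e\<close>. The function \<open>c\<close> assigns
  to every triple the pair chosen from it.\<close>

definition is_TCM :: "nat \<Rightarrow> nat set multiset \<Rightarrow> bool" where
  "is_TCM m G \<longleftrightarrow>
     (\<exists>c. (\<forall>T \<in> vertex_subsets m 3. c T \<subseteq> T \<and> card (c T) = 2) \<and>
          G = image_mset c (mset_set (vertex_subsets m 3)))"

text \<open>The sum includes the pairs of multiplicity \<open>0\<close>, each of which contributes \<open>1\<close>.\<close>

definition weight :: "nat \<Rightarrow> nat set multiset \<Rightarrow> real \<Rightarrow> real" where
  "weight m G q = (\<Sum>e \<in> vertex_subsets m 2. q ^ count G e)"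

definition H :: "nat \<Rightarrow> real \<Rightarrow> real" where
  "H m q = Max {weight m G q | G. is_TCM m G}"

text \<open>The set whose maximum is taken is finite and nonempty, so \<open>Max\<close> is a genuine maximum.\<close>

lemma finite_vertex_subsets: "finite (vertex_subsets m k)"
  unfolding vertex_subsets_def by (rule finite_subset[of _ "Pow {1..m}"]) auto

lemma finite_TCMs: "finite {G. is_TCM m G}"
proof (rule finite_subset)
  let ?n = "card (vertex_subsets m 3)"
  show "{G. is_TCM m G} \<subseteq> mset ` {xs. set xs \<subseteq> Pow {1..m} \<and> length xs = ?n}"
  proof
    fix G assume "G \<in> {G. is_TCM m G}"
    then obtain c where c: "\<forall>T \<in> vertex_subsets m 3. c T \<subseteq> T"
      and G: "G = image_mset c (mset_set (vertex_subsets m 3))"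
      by (auto simp: is_TCM_def)
    obtain xs where xs: "mset xs = G" using ex_mset by blast
    have "set xs = c ` vertex_subsets m 3"
      using arg_cong[OF xs, of set_mset] by (simp add: G finite_vertex_subsets)
    then have "set xs \<subseteq> Pow {1..m}"
      using c unfolding vertex_subsets_def by blast
    moreover have "length xs = ?n"
      using arg_cong[OF xs, of size] by (simp add: G)
    ultimately show "G \<in> mset ` {xs. set xs \<subseteq> Pow {1..m} \<and> length xs = ?n}"
      using xs by blast
  qed
  show "finite (mset ` {xs. set xs \<subseteq> Pow {1..m} \<and> length xs = ?n})"
    by (intro finite_imageI finite_lists_length_eq) simp
qed

lemma ex_TCM: "\<exists>G. is_TCM m G"
proof -
  have "\<forall>T \<in> vertex_subsets m 3. \<exists>e. e \<subseteq> T \<and> card e = 2"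
  proof
    fix T assume "T \<in> vertex_subsets m 3"
    then have "2 \<le> card T" by (simp add: vertex_subsets_def)
    then show "\<exists>e. e \<subseteq> T \<and> card e = 2" by (meson obtain_subset_with_card_n)
  qed
  then have "\<exists>c. \<forall>T \<in> vertex_subsets m 3. c T \<subseteq> T \<and> card (c T) = 2"
    by (rule bchoice)
  then show ?thesis unfolding is_TCM_def by blast
qed

lemma H_attained: "\<exists>G. is_TCM m G \<and> H m q = weight m G q"
proof -
  have "finite {weight m G q | G. is_TCM m G}"
    unfolding setcompr_eq_image by (intro finite_imageI finite_TCMs)
  moreover have "{weight m G q | G. is_TCM m G} \<noteq> {}" using ex_TCM by blast
  ultimately have "H m q \<in> {weight m G q | G. is_TCM m G}"
    unfolding H_def by (rule Max_in)
  then show ?thesis by blast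
qed

lemma weight_le_H: "is_TCM m G \<Longrightarrow> weight m G q \<le> H m q"
  unfolding H_def setcompr_eq_image
  by (intro Max_ge finite_imageI finite_TCMs imageI CollectI)

end

theory Submission
  imports Defs
begin

text \<open>Call an edge of the induced TCM on \<open>S\<close> full if it is chosen from every triple of \<open>S\<close>
  containing it. Two full edges never share a vertex, and an edge of multiplicity \<open>k\<close> is full in
  exactly \<open>2\<^sup>k\<close> sets \<open>S\<close>; hence twice the weight is the number of pairs \<open>(y, S)\<close> such that \<open>y\<close> is
  matched by a full edge of \<open>S\<close>. It remains to show that many of the \<open>m 2\<^bsup>m-1\<^esup>\<close> pairs with
  \<open>y \<in> S\<close> are unmatched.

  Let \<open>y\<close> be matched to \<open>x\<close> in \<open>S\<close> and delete \<open>x\<close>. If \<open>y\<close> is matched to some \<open>z\<close> in \<open>S - {x}\<close>, then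
  \<open>z\<close> is unmatched in \<open>S\<close>, and \<open>(z, S)\<close> arises from at most two \<open>y\<close>. Otherwise \<open>y\<close> is unmatched in
  \<open>T = S - {x}\<close>. If this happens for \<open>t\<close> different \<open>x\<close> with the same \<open>(y, T)\<close>, then adding two of
  them to \<open>T\<close> gives a pair that is not of this second kind and that determines \<open>T\<close>, and
  \<open>t \<le> 1 + (t choose 2)\<close>. With \<open>M\<close> matched and \<open>U\<close> unmatched pairs this yields
  \<open>M \<le> 2U + (U + m 2\<^bsup>m-1\<^esup>) / 2\<close>, that is \<open>M \<le> (6/7) m 2\<^bsup>m-1\<^esup>\<close>, and \<open>3/7 < 83/192\<close>.\<close>

section \<open>Full edges, and the matched and unmatched pairs they define\<close>

definition full :: "('a set \<Rightarrow> 'a set) \<Rightarrow> 'a set \<Rightarrow> 'a \<Rightarrow> 'a \<Rightarrow> bool" where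
  "full c S x y \<longleftrightarrow> x \<in> S \<and> y \<in> S \<and> x \<noteq> y \<and> (\<forall>w \<in> S - {x, y}. c {x, y, w} = {x, y})"

definition matched :: "('a set \<Rightarrow> 'a set) \<Rightarrow> 'a set \<Rightarrow> 'a \<Rightarrow> bool" where
  "matched c S y \<longleftrightarrow> (\<exists>x. full c S y x)"

definition pointed_sets :: "'a set \<Rightarrow> ('a \<times> 'a set) set" where
  "pointed_sets V = {(y, S). y \<in> S \<and> S \<subseteq> V}"

definition matched_pairs :: "('a set \<Rightarrow> 'a set) \<Rightarrow> 'a set \<Rightarrow> ('a \<times> 'a set) set" where
  "matched_pairs c V = {(y, S) \<in> pointed_sets V. matched c S y}"

definition unmatched_pairs :: "('a set \<Rightarrow> 'a set) \<Rightarrow> 'a set \<Rightarrow> ('a \<times> 'a set) set" where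
  "unmatched_pairs c V = {(y, S) \<in> pointed_sets V. \<not> matched c S y}"

text \<open>The second kind in the overview, \<open>stable_pairs\<close> being the first. By
  \<open>full_unique\<close> the witness \<open>x\<close> is the only partner of \<open>y\<close> in
  \<open>S\<close>.\<close>

definition fragile_pairs :: "('a set \<Rightarrow> 'a set) \<Rightarrow> 'a set \<Rightarrow> ('a \<times> 'a set) set" where
  "fragile_pairs c V =
     {(y, S) \<in> pointed_sets V. \<exists>x. full c S y x \<and> \<not> matched c (S - {x}) y}"

definition stable_pairs :: "('a set \<Rightarrow> 'a set) \<Rightarrow> 'a set \<Rightarrow> ('a \<times> 'a set) set" where
  "stable_pairs c V =
     {(y, S) \<in> pointed_sets V. \<exists>x. full c S y x \<and> matched c (S - {x}) y}"

lemma full_sym: "full c S x y \<Longrightarrow> full c S y x"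
  by (auto simp: full_def insert_commute)

text \<open>Otherwise the triple of \<open>x\<close>, \<open>y\<close>, \<open>z\<close> would have
  to choose two different pairs.\<close>

lemma full_unique:
  assumes "full c S x y" "full c S x z"
  shows "y = z"
proof (rule ccontr)
  assume "y \<noteq> z"
  then have "c {x, y, z} = {x, y}" "c {x, z, y} = {x, z}"
    using assms unfolding full_def by auto
  then have "{x, y} = {x, z}" by (simp add: insert_commute)
  with \<open>y \<noteq> z\<close> assms show False unfolding full_def by (auto simp: doubleton_eq_iff)
qed

lemma full_mono: "full c S x y \<Longrightarrow> T \<subseteq> S \<Longrightarrow> x \<in> T \<Longrightarrow> y \<in> T \<Longrightarrow> full c T x y"
  by (auto simp: full_def)

section \<open>Counting pointed sets\<close>

lemma finite_pointed_sets: "finite V \<Longrightarrow> finite (pointed_sets V)"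
  by (rule finite_subset[of _ "V \<times> Pow V"]) (auto simp: pointed_sets_def)

lemma card_pointed_sets:
  assumes "finite V"
  shows "card (pointed_sets V) = card V * 2 ^ (card V - 1)"
proof -
  have eq: "pointed_sets V = (\<lambda>(y, T). (y, insert y T)) ` (SIGMA y:V. Pow (V - {y}))"
    (is "_ = ?R")
  proof
    show "pointed_sets V \<subseteq> ?R"
    proof
      fix p assume "p \<in> pointed_sets V"
      then obtain y S where "p = (y, S)" "y \<in> S" "S \<subseteq> V" by (auto simp: pointed_sets_def)
      then show "p \<in> ?R" by (intro rev_image_eqI[of "(y, S - {y})"]) auto
    qed
  qed (auto simp: pointed_sets_def)
  have "inj_on (\<lambda>(y, T). (y, insert y T)) (SIGMA y:V. Pow (V - {y}))"
    by (auto simp: inj_on_def)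
  then have "card (pointed_sets V) = (\<Sum>y\<in>V. card (Pow (V - {y})))"
    using assms by (simp add: eq card_image)
  also have "\<dots> = (\<Sum>y\<in>V. 2 ^ (card V - 1))"
    using assms by (intro sum.cong) (auto simp: card_Pow)
  finally show ?thesis by simp
qed

lemma card_matched_add_unmatched:
  assumes "finite V"
  shows "card (matched_pairs c V) + card (unmatched_pairs c V) = card V * 2 ^ (card V - 1)"
proof -
  have "pointed_sets V = matched_pairs c V \<union> unmatched_pairs c V"
    "matched_pairs c V \<inter> unmatched_pairs c V = {}"
    by (auto simp: matched_pairs_def unmatched_pairs_def)
  then show ?thesis
    using card_Un_disjoint[of "matched_pairs c V" "unmatched_pairs c V"]
      finite_pointed_sets[OF assms] card_pointed_sets[OF assms] by (metis finite_Un)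
qed

lemma card_matched_le:
  assumes "finite V"
  shows "card (matched_pairs c V) \<le> card (fragile_pairs c V) + card (stable_pairs c V)"
proof -
  have "matched_pairs c V \<subseteq> fragile_pairs c V \<union> stable_pairs c V"
    by (auto simp: matched_pairs_def fragile_pairs_def stable_pairs_def matched_def)
  moreover have "finite (fragile_pairs c V \<union> stable_pairs c V)"
    by (rule finite_subset[OF _ finite_pointed_sets[OF assms]])
      (auto simp: fragile_pairs_def stable_pairs_def)
  ultimately show ?thesis
    by (meson card_Un_le card_mono le_trans)
qed

section \<open>Charging stable pairs to unmatched pairs\<close>

text \<open>A partner of \<open>z\<close> in \<open>S\<close> is not \<open>x\<close>, whose partner
  is \<open>y\<close>. So it survives the deletion of \<open>x\<close> and must be \<open>y\<close>,
  which then has both \<open>x\<close> and \<open>z\<close> as partners in \<open>S\<close>.\<close>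

lemma unmatched_second_partner:
  assumes xy: "full c S y x" and yz: "full c (S - {x}) y z"
  shows "\<not> matched c S z"
proof
  assume "matched c S z"
  then obtain w where zw: "full c S z w" by (auto simp: matched_def)
  have "w \<noteq> x"
    using full_unique[OF full_sym[OF xy], of z] full_sym[OF zw] yz by (auto simp: full_def)
  then have "full c (S - {x}) z w"
    using full_mono[OF zw, of "S - {x}"] zw yz by (auto simp: full_def)
  then have "w = y" using full_unique full_sym[OF yz] by metis
  then have "full c S y z" using full_sym[OF zw] by simp
  then have "z = x" using full_unique xy by metis
  with yz show False by (auto simp: full_def)
qed

lemma card_stable_le:
  assumes "finite V"
  shows "card (stable_pairs c V) \<le> 2 * card (unmatched_pairs c V)"
proof -
  \<comment> \<open>\<open>R (z, S)\<close> collects the pairs \<open>(y, S)\<close> for which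
    \<open>z\<close> becomes the partner of \<open>y\<close> once the old partner is
    deleted.\<close>
  define R where "R = (\<lambda>(z, S). {(y, S) | y. \<exists>x. full c S y x \<and> full c (S - {x}) y z})"
  have fin: "finite (unmatched_pairs c V)"
    by (rule finite_subset[OF _ finite_pointed_sets[OF assms]]) (auto simp: unmatched_pairs_def)
  have R: "finite (R p) \<and> card (R p) \<le> 2" for p
  proof (cases "R p = {}")
    case False
    obtain z S where p: "p = (z, S)" by force
    from False obtain y x where y: "full c S y x" "full c (S - {x}) y z"
      by (auto simp: p R_def)
    \<comment> \<open>For a third vertex \<open>y'\<close>, the triple of \<open>y\<close>,
      \<open>y'\<close>, \<open>z\<close> avoids both deleted vertices \<open>x\<close> and
      \<open>x'\<close>, so it would choose both \<open>{y, z}\<close> and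
      \<open>{y', z}\<close>.\<close>
    have "y' = y \<or> y' = x" if y': "full c S y' x'" "full c (S - {x'}) y' z" for y' x'
    proof (rule ccontr)
      assume "\<not> (y' = y \<or> y' = x)"
      then have ne: "y' \<noteq> y" "y' \<noteq> x" by auto
      then have "y \<noteq> x'" using full_unique[OF y(1)] full_sym[OF y'(1)] by metis
      then have "c {y, z, y'} = {y, z}" "c {y', z, y} = {y', z}"
        using y y' ne unfolding full_def by auto
      moreover have "{y', z, y} = {y, z, y'}" by auto
      ultimately have "{y, z} = {y', z}" by metis
      with ne show False by (auto simp: doubleton_eq_iff)
    qed
    then have "R p \<subseteq> {(y, S), (x, S)}" by (auto simp: p R_def)
    moreover have "card {(y, S), (x, S)} \<le> 2" by (simp add: card_insert_if)
    ultimately show ?thesis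
      by (meson card_mono finite.emptyI finite.insertI finite_subset le_trans)
  qed simp
  have "stable_pairs c V \<subseteq> (\<Union>p\<in>unmatched_pairs c V. R p)"
  proof
    fix p assume "p \<in> stable_pairs c V"
    then obtain y S x z where p: "p = (y, S)" "S \<subseteq> V"
      and f: "full c S y x" "full c (S - {x}) y z"
      by (auto simp: stable_pairs_def matched_def pointed_sets_def)
    then have "(z, S) \<in> unmatched_pairs c V"
      using unmatched_second_partner[OF f]
      by (auto simp: unmatched_pairs_def pointed_sets_def full_def)
    moreover have "p \<in> R (z, S)" using p f by (auto simp: R_def)
    ultimately show "p \<in> (\<Union>p\<in>unmatched_pairs c V. R p)" by blast
  qed
  then have "card (stable_pairs c V) \<le> card (\<Union>p\<in>unmatched_pairs c V. R p)"
    using fin R by (intro card_mono) auto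
  also have "\<dots> \<le> (\<Sum>p\<in>unmatched_pairs c V. card (R p))"
    by (rule card_UN_le[OF fin])
  also have "\<dots> \<le> (\<Sum>p\<in>unmatched_pairs c V. 2)"
    using R by (intro sum_mono) auto
  finally show ?thesis by simp
qed

section \<open>Bounding fragile pairs by two-vertex extensions\<close>

lemma le_Suc_choose_two: "t \<le> 1 + (t choose 2)"
proof (induction t)
  case (Suc t)
  then show ?case by (cases t) (auto simp: numeral_2_eq_2)
qed simp

lemma card_fragile_le:
  assumes "finite V"
  shows "2 * card (fragile_pairs c V) \<le> card (unmatched_pairs c V) + card V * 2 ^ (card V - 1)"
proof -
  \<comment> \<open>\<open>X (y, T)\<close> holds the vertices that become partners of
    \<open>y\<close> when added alone to \<open>T\<close>; \<open>f\<close> adds two of them at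
    once.\<close>
  define X where "X = (\<lambda>(y, T). {x \<in> V - T. full c (insert x T) y x})"
  define D where "D = (SIGMA p:unmatched_pairs c V. {P. P \<subseteq> X p \<and> card P = 2})"
  define f where "f = (\<lambda>((y :: 'a, T :: 'a set), P). (y, T \<union> P))"
  have finP: "finite (pointed_sets V)" by (rule finite_pointed_sets[OF assms])
  have finU: "finite (unmatched_pairs c V)"
    by (rule finite_subset[OF _ finP]) (auto simp: unmatched_pairs_def)
  have finX: "finite (X p)" for p
    using assms by (auto simp: X_def split: prod.splits)
  have sub: "fragile_pairs c V \<subseteq> pointed_sets V" by (auto simp: fragile_pairs_def)
  have "fragile_pairs c V \<subseteq> (\<lambda>((y, T), x). (y, insert x T)) ` (SIGMA p:unmatched_pairs c V. X p)"
  proof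
    fix p assume "p \<in> fragile_pairs c V"
    then obtain y S x where p: "p = (y, S)" "y \<in> S" "S \<subseteq> V" "full c S y x"
        "\<not> matched c (S - {x}) y"
      by (auto simp: fragile_pairs_def pointed_sets_def)
    then have x: "x \<in> S" "x \<noteq> y" "insert x (S - {x}) = S" by (auto simp: full_def)
    then have "((y, S - {x}), x) \<in> (SIGMA p:unmatched_pairs c V. X p)"
      using p by (auto simp: X_def unmatched_pairs_def pointed_sets_def insert_absorb)
    then show "p \<in> (\<lambda>((y, T), x). (y, insert x T)) ` (SIGMA p:unmatched_pairs c V. X p)"
      using p x by (auto intro!: rev_image_eqI)
  qed
  then have "card (fragile_pairs c V) \<le> card (SIGMA p:unmatched_pairs c V. X p)"
    using finU finX by (intro surj_card_le finite_SigmaI) auto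
  also have "\<dots> = (\<Sum>p\<in>unmatched_pairs c V. card (X p))"
    using finU finX by simp
  also have "\<dots> \<le> (\<Sum>p\<in>unmatched_pairs c V. 1 + card {P. P \<subseteq> X p \<and> card P = 2})"
    using finX by (intro sum_mono) (simp only: n_subsets le_Suc_choose_two)
  also have "\<dots> = card (unmatched_pairs c V) + card D"
    unfolding sum.distrib D_def using finU finX by (subst card_SigmaI) auto
  also have "card D \<le> card (pointed_sets V - fragile_pairs c V)"
  proof (rule card_inj_on_le)
    show "finite (pointed_sets V - fragile_pairs c V)" using finP by simp
    show "f ` D \<subseteq> pointed_sets V - fragile_pairs c V"
    proof
      fix q assume "q \<in> f ` D"
      then obtain y T P where q: "q = (y, T \<union> P)" and U: "(y, T) \<in> unmatched_pairs c V"
        and P: "P \<subseteq> X (y, T)" "card P = 2"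
        by (auto simp: f_def D_def)
      from P obtain i j where ij: "P = {i, j}" "i \<noteq> j" by (auto simp: card_2_iff)
      with P have i: "i \<in> V - T" "full c (insert i T) y i"
        and j: "j \<in> V - T" "full c (insert j T) y j" by (auto simp: X_def)
      have yT: "y \<in> T" "T \<subseteq> V" using U by (auto simp: unmatched_pairs_def pointed_sets_def)
      \<comment> \<open>A partner of \<open>y\<close> inside \<open>T\<close> would compete with
        \<open>i\<close> in \<open>insert i T\<close>, so \<open>x\<close> is \<open>i\<close> or
        \<open>j\<close>. After its deletion the other one matches \<open>y\<close>, hence the pair
        is not fragile.\<close>
      have "matched c (T \<union> P - {x}) y" if x: "full c (T \<union> P) y x" for x
      proof -
        have "x \<notin> T"
        proof
          assume "x \<in> T"
          then have "full c (insert i T) y x"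
            using full_mono[OF x, of "insert i T"] ij yT by auto
          then have "x = i" using full_unique i by metis
          with \<open>x \<in> T\<close> i show False by simp
        qed
        then have "x = i \<or> x = j" using x ij by (auto simp: full_def)
        moreover have "T \<union> P - {i} = insert j T" "T \<union> P - {j} = insert i T"
          using ij i j by auto
        ultimately show ?thesis using i j by (auto simp: matched_def)
      qed
      then show "q \<in> pointed_sets V - fragile_pairs c V"
        using q ij i j yT by (auto simp: fragile_pairs_def pointed_sets_def)
    qed
    show "inj_on f D"
    proof (rule inj_onI)
      fix p q assume "p \<in> D" "q \<in> D" "f p = f q"
      then obtain y T P T' P' where pq: "p = ((y, T), P)" "q = ((y, T'), P')"
        and eq: "T \<union> P = T' \<union> P'" and y: "y \<in> T" "y \<in> T'"
        and P: "P \<subseteq> X (y, T)" "card P = 2" and P': "P' \<subseteq> X (y, T')" "card P' = 2"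
        by (auto simp: f_def D_def unmatched_pairs_def pointed_sets_def)
      have disj: "P \<inter> T = {}" "P' \<inter> T' = {}" using P P' by (auto simp: X_def)
      have "P = P'"
      proof (rule ccontr)
        assume "P \<noteq> P'"
        have "finite P" "finite P'" using P P' by (simp_all add: card_ge_0_finite)
        then have "\<not> P \<subseteq> P'" "\<not> P' \<subseteq> P"
          using \<open>P \<noteq> P'\<close> P P' by (metis card_subset_eq)+
        then obtain a b where a: "a \<in> P" "a \<notin> P'" and b: "b \<in> P'" "b \<notin> P" by blast
        \<comment> \<open>Each base set contains the vertex added to the other, so the triple of
          \<open>y\<close>, \<open>a\<close>, \<open>b\<close> lies in both extensions and would
          choose \<open>{y, a}\<close> as well as \<open>{y, b}\<close>.\<close>
        then have "a \<in> T'" "b \<in> T" using eq by blast+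
        moreover have "full c (insert a T) y a" "full c (insert b T') y b"
          using a b P P' by (auto simp: X_def)
        moreover have "a \<noteq> b" "a \<noteq> y" "b \<noteq> y" using a b y disj by auto
        ultimately have "c {y, a, b} = {y, a}" "c {y, b, a} = {y, b}"
          by (auto simp: full_def)
        then have "{y, a} = {y, b}" by (simp add: insert_commute)
        with \<open>a \<noteq> b\<close> show False by (auto simp: doubleton_eq_iff)
      qed
      moreover from this have "T = T'" using eq disj by blast
      ultimately show "p = q" using pq by simp
    qed
  qed
  \<comment> \<open>Moving the subtracted fragile pairs to the left produces the factor 2
    there.\<close>
  also have "\<dots> = card V * 2 ^ (card V - 1) - card (fragile_pairs c V)"
    using sub finP by (simp add: card_Diff_subset finite_subset card_pointed_sets[OF assms])
  finally show ?thesis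
    using card_mono[OF finP sub] card_pointed_sets[OF assms] by simp
qed

text \<open>Doubling the split into fragile and stable pairs gives 2M <= 5U + N, where N = M + U
  counts all pointed sets.\<close>

lemma card_matched_pairs_le:
  assumes "finite V"
  shows "7 * card (matched_pairs c V) \<le> 6 * (card V * 2 ^ (card V - 1))"
  using card_matched_add_unmatched[OF assms, of c] card_matched_le[OF assms, of c]
    card_stable_le[OF assms, of c] card_fragile_le[OF assms, of c] by linarith

section \<open>From the weight to matched pairs\<close>

lemma weight_le_card_matched_pairs:
  assumes c: "\<forall>T \<in> vertex_subsets m 3. c T \<subseteq> T \<and> card (c T) = 2"
    and G: "G = image_mset c (mset_set (vertex_subsets m 3))"
  shows "2 * weight m G 2 \<le> real (card (matched_pairs c {1..m}))"
proof -
  let ?V = "{1..m}"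
  \<comment> \<open>For \<open>e\<close> a pair and \<open>B\<close> disjoint from it,
    \<open>e\<close> is full in \<open>e \<union> B\<close> exactly when
    \<open>B \<subseteq> W e\<close>. The component \<open>y\<close> of \<open>A\<close> picks an
    endpoint of \<open>e\<close>, whence the factor 2.\<close>
  define W where "W e = {w \<in> ?V - e. c (insert w e) = e}" for e
  define A where "A = (SIGMA e:vertex_subsets m 2. e \<times> Pow (W e))"
  define g where "g = (\<lambda>(e :: nat set, y :: nat, B). (y, e \<union> B))"
  have finW: "finite (W e)" for e by (simp add: W_def)
  have count: "count G e \<le> card (W e)" for e
  proof -
    have "count G e = card {T \<in> vertex_subsets m 3. c T = e}"
      by (simp add: G count_image_mset finite_vertex_subsets vimage_def Int_def conj_commute)
    also have "\<dots> \<le> card ((\<lambda>w. insert w e) ` W e)"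
    proof (intro card_mono finite_imageI finW subsetI)
      fix T assume "T \<in> {T \<in> vertex_subsets m 3. c T = e}"
      then have T: "T \<subseteq> ?V" "card T = 3" "e \<subseteq> T" "card e = 2" "c T = e"
        using c by (auto simp: vertex_subsets_def)
      then have "card (T - e) = 1"
        by (subst card_Diff_subset) (auto intro: card_ge_0_finite)
      then obtain w where "T - e = {w}" by (auto simp: card_1_singleton_iff)
      with T have Te: "T = insert w e" by blast
      moreover have "w \<in> W e" using \<open>T - e = {w}\<close> T Te by (auto simp: W_def)
      ultimately show "T \<in> (\<lambda>w. insert w e) ` W e" by blast
    qed
    also have "\<dots> \<le> card (W e)" by (rule card_image_le[OF finW])
    finally show ?thesis .
  qed
  have fin: "finite e" if "e \<in> vertex_subsets m 2" for e
    using that by (auto simp: vertex_subsets_def intro: card_ge_0_finite)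
  have full: "\<exists>x. e = {y, x} \<and> full c (e \<union> B) y x" if A: "(e, y, B) \<in> A" for e y B
  proof -
    from A have e: "card e = 2" "y \<in> e" "B \<subseteq> W e" by (auto simp: A_def vertex_subsets_def)
    then obtain x where x: "e = {y, x}" "x \<noteq> y" by (auto simp: card_2_iff doubleton_eq_iff)
    have "c {y, x, w} = {y, x}" if "w \<in> B" for w
      using that e x by (auto simp: W_def insert_commute)
    with x show ?thesis by (auto simp: full_def)
  qed
  have "card A \<le> card (matched_pairs c ?V)"
  proof (rule card_inj_on_le)
    show "inj_on g A"
    proof (rule inj_onI)
      fix p q assume pq: "p \<in> A" "q \<in> A" "g p = g q"
      then obtain e y B e' B' where p: "p = (e, y, B)" "q = (e', y, B')" "e \<union> B = e' \<union> B'"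
        by (cases p; cases q) (auto simp: g_def)
      obtain x x' where "e = {y, x}" "full c (e \<union> B) y x" "e' = {y, x'}" "full c (e' \<union> B') y x'"
        using full pq p by metis
      \<comment> \<open>The unique partner of \<open>y\<close> recovers \<open>e\<close> from the
        image; \<open>B\<close> is what remains.\<close>
      then have "e = e'" using full_unique p(3) by metis
      moreover have "e \<inter> B = {}" "e' \<inter> B' = {}" using pq p by (auto simp: A_def W_def)
      ultimately show "p = q" using p by blast
    qed
    show "g ` A \<subseteq> matched_pairs c ?V"
    proof
      fix q assume "q \<in> g ` A"
      then obtain e y B where q: "q = (y, e \<union> B)" "(e, y, B) \<in> A" by (auto simp: g_def)
      then have "e \<union> B \<subseteq> ?V" "y \<in> e" by (auto simp: A_def W_def vertex_subsets_def)
      with q full[OF q(2)] show "q \<in> matched_pairs c ?V"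
        by (auto simp: matched_pairs_def pointed_sets_def matched_def)
    qed
    show "finite (matched_pairs c ?V)"
      by (rule finite_subset[OF _ finite_pointed_sets[of ?V]]) (auto simp: matched_pairs_def)
  qed
  moreover have "card A = (\<Sum>e\<in>vertex_subsets m 2. 2 * 2 ^ card (W e))"
    unfolding A_def using fin finW
    by (subst card_SigmaI)
      (auto simp: finite_vertex_subsets card_cartesian_product card_Pow vertex_subsets_def
        intro!: sum.cong)
  moreover have "2 * weight m G 2 \<le> real (\<Sum>e\<in>vertex_subsets m 2. 2 * 2 ^ card (W e))"
    unfolding weight_def sum_distrib_left of_nat_sum using count by (intro sum_mono) simp
  ultimately show ?thesis by linarith
qed

theorem theorem1p6:
  fixes m :: nat
  shows "H m 2 \<le> 83 / 192 * real m * 2 powi (int m - 1)"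
proof (cases m)
  \<comment> \<open>Here both sides are 0; for positive \<open>m\<close> the integer exponent
    becomes the natural number \<open>n\<close>.\<close>
  case 0
  have "vertex_subsets 0 2 = {}" by (auto simp: vertex_subsets_def)
  then show ?thesis using 0 H_attained[of 0 2] by (auto simp: weight_def)
next
  case (Suc n)
  obtain G where "is_TCM m G" and HG: "H m 2 = weight m G 2"
    using H_attained by blast
  then obtain c where c: "\<forall>T \<in> vertex_subsets m 3. c T \<subseteq> T \<and> card (c T) = 2"
    and G: "G = image_mset c (mset_set (vertex_subsets m 3))"
    by (auto simp: is_TCM_def)
  have "real (7 * card (matched_pairs c {1..m})) \<le> real (6 * (m * 2 ^ n))"
    using card_matched_pairs_le[of "{1..m}" c] Suc by (intro of_nat_mono) simp
  then have "7 * (2 * H m 2) \<le> 6 * (real m * 2 ^ n)"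
    using weight_le_card_matched_pairs[OF c G] HG by simp
  moreover have "0 \<le> real m * 2 ^ n" by simp
  \<comment> \<open>The factor obtained is 3/7, and 3 * 192 = 576 < 581 = 7 * 83.\<close>
  ultimately have "H m 2 \<le> 83 / 192 * (real m * 2 ^ n)" by linarith
  moreover have "(2 :: real) powi (int m - 1) = 2 ^ n" using Suc by simp
  ultimately show ?thesis by simp
qed

end
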